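(* Let $X$ be a real random variable with finite variance and finite differential entropy, let $W\sim\mathcal N(0,\sigma_W^2)$ with $\sigma_W^2>0$ be independent of $X$, and let $Y=X+W$. Then $$h\big(\mathbb E[X\mid Y]\big)=h(Y)+\mathbb E\left[\log\left(\frac{1}{\sigma_W^2}\operatorname{Var}(X\mid Y)\right)\right],$$ and moreover $$h\big(\mathbb E[X\mid Y]\big)+h(Y)\ \ge\ 2h(X).$$
   Context: $h(\cdot)$ denotes differential entropy, $h(Z)=-\int p_Z(z)\log p_Z(z)\,dz$, with natural logarithm. $\operatorname{Var}(X\mid Y)=\mathbb E[(X-\mathbb E[X\mid Y])^2\mid Y]$ is the conditional variance (a function of $Y$). *)

theory Defs
  imports "HOL-Probability.Probability"
begin

definition diff_entropy :: "'a measure \<Rightarrow> ('a \<Rightarrow> real) \<Rightarrow> real" where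
  "diff_entropy M Z = prob_space.entropy M (exp 1) lborel Z"

definition has_finite_diff_entropy :: "'a measure \<Rightarrow> ('a \<Rightarrow> real) \<Rightarrow> bool" where
  "has_finite_diff_entropy M Z \<longleftrightarrow>
     (\<exists>p. distributed M lborel Z (\<lambda>x. ennreal (p x)) \<and> (\<forall>x. 0 \<le> p x) \<and>
          integrable lborel (\<lambda>x. p x * ln (p x)))"

definition cond_exp_given :: "'a measure \<Rightarrow> ('a \<Rightarrow> real) \<Rightarrow> ('a \<Rightarrow> real) \<Rightarrow> ('a \<Rightarrow> real)" where
  "cond_exp_given M Y Z = real_cond_exp M (vimage_algebra (space M) Y borel) Z"

definition cond_var_given :: "'a measure \<Rightarrow> ('a \<Rightarrow> real) \<Rightarrow> ('a \<Rightarrow> real) \<Rightarrow> ('a \<Rightarrow> real)" where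
  "cond_var_given M Y Z = cond_exp_given M Y (\<lambda>\<omega>. (Z \<omega> - cond_exp_given M Y Z \<omega>)\<^sup>2)"

end

theory Submission
  imports Defs
begin

text \<open>
  Let \<open>q\<close> be the density of the output and \<open>m y\<close>, \<open>v y\<close> the mean and variance of the input given
  the output \<open>y\<close>. Differentiating the Gaussian convolutions under the integral gives
  \<open>m' = v / \<sigma>\<^sup>2\<close>, which is positive because the input has a density. Hence \<open>m\<close> is an increasing
  diffeomorphism onto its range, the conditional expectation has density \<open>q / m'\<close> transported
  along \<open>m\<close>, and the entropy identity follows by taking logarithms.

  For the inequality, compare the joint density \<open>f x y = p x * \<phi> (y - x)\<close> with
  \<open>g x y = q y * N(m y, v y) x\<close>. Integrating \<open>ln (g / f) \<le> g / f - 1\<close> against \<open>f\<close> gives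
  \<open>E (ln (v Y / \<sigma>\<^sup>2)) \<ge> 2 h(X) - 2 h(Y)\<close>; since the bound is pointwise, it also shows that the
  negative part of \<open>ln (v Y)\<close> is integrable.
\<close>

section \<open>Integration and entropy\<close>

text \<open>The mean value bound puts every difference quotient below \<open>g\<close>, so dominated
  convergence applies along each null sequence of increments.\<close>

lemma has_real_derivative_integral_dominated:
  fixes f f' :: "real \<Rightarrow> 'a \<Rightarrow> real"
  assumes int: "\<And>y. integrable M (f y)"
    and meas: "\<And>y. f' y \<in> borel_measurable M"
    and deriv: "\<And>y \<omega>. ((\<lambda>y. f y \<omega>) has_real_derivative f' y \<omega>) (at y)"
    and bound: "\<And>y \<omega>. \<bar>f' y \<omega>\<bar> \<le> g \<omega>"
    and g: "integrable M g"
  shows "((\<lambda>y. \<integral>\<omega>. f y \<omega> \<partial>M) has_real_derivative (\<integral>\<omega>. f' y \<omega> \<partial>M)) (at y)"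
  unfolding DERIV_def tendsto_at_iff_sequentially
proof (intro allI impI)
  fix u :: "nat \<Rightarrow> real" assume u: "\<forall>i. u i \<in> UNIV - {0}" "u \<longlonglongrightarrow> 0"
  have quot: "norm ((f (y + u i) \<omega> - f y \<omega>) / u i) \<le> g \<omega>" for i \<omega>
  proof -
    have "norm (f (y + u i) \<omega> - f y \<omega>) \<le> g \<omega> * norm ((y + u i) - y)"
      by (rule field_differentiable_bound[where S=UNIV and f="\<lambda>y. f y \<omega>" and f'="\<lambda>y. f' y \<omega>"])
        (use deriv bound in auto)
    then show ?thesis
      using u(1) by (simp add: field_simps)
  qed
  have "(\<lambda>i. \<integral>\<omega>. (f (y + u i) \<omega> - f y \<omega>) / u i \<partial>M) \<longlonglongrightarrow> (\<integral>\<omega>. f' y \<omega> \<partial>M)"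
  proof (rule integral_dominated_convergence[where w=g])
    show "AE \<omega> in M. (\<lambda>i. (f (y + u i) \<omega> - f y \<omega>) / u i) \<longlonglongrightarrow> f' y \<omega>"
    proof (intro AE_I2)
      fix \<omega>
      show "(\<lambda>i. (f (y + u i) \<omega> - f y \<omega>) / u i) \<longlonglongrightarrow> f' y \<omega>"
        using deriv[of \<omega> y] u unfolding DERIV_def tendsto_at_iff_sequentially
        by (auto simp: o_def)
    qed
  qed (use int meas g quot in \<open>auto intro!: borel_measurable_divide borel_measurable_diff\<close>)
  also have "(\<lambda>i. \<integral>\<omega>. (f (y + u i) \<omega> - f y \<omega>) / u i \<partial>M)
      = (\<lambda>h. ((\<integral>\<omega>. f (y + h) \<omega> \<partial>M) - (\<integral>\<omega>. f y \<omega> \<partial>M)) / h) \<circ> u"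
    using int by (auto simp: o_def fun_eq_iff)
  finally show "((\<lambda>h. ((\<integral>\<omega>. f (y + h) \<omega> \<partial>M) - (\<integral>\<omega>. f y \<omega> \<partial>M)) / h) \<circ> u)
      \<longlonglongrightarrow> (\<integral>\<omega>. f' y \<omega> \<partial>M)" .
qed

text \<open>Needed besides differentiability because \<open>mom 2\<close> enters the derivative of
  \<open>post_mean\<close>, and for it only continuity is established.\<close>

lemma isCont_integral_dominated:
  fixes f :: "real \<Rightarrow> 'a \<Rightarrow> real"
  assumes meas: "\<And>y. f y \<in> borel_measurable M"
    and cont: "\<And>y \<omega>. isCont (\<lambda>y. f y \<omega>) y"
    and bound: "\<And>y \<omega>. \<bar>f y \<omega>\<bar> \<le> g \<omega>"
    and g: "integrable M g"
  shows "isCont (\<lambda>y. \<integral>\<omega>. f y \<omega> \<partial>M) y"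
  unfolding continuous_at_sequentially o_def
proof (intro allI impI)
  fix u :: "nat \<Rightarrow> real" assume u: "u \<longlonglongrightarrow> y"
  show "(\<lambda>i. \<integral>\<omega>. f (u i) \<omega> \<partial>M) \<longlonglongrightarrow> (\<integral>\<omega>. f y \<omega> \<partial>M)"
    by (rule integral_dominated_convergence[where w=g])
      (use meas bound g isCont_tendsto_compose[OF cont u] in auto)
qed

section \<open>Increasing changes of variables\<close>

text \<open>Substitution on the intervals \<open>{-real n..real n}\<close> passes to the whole line
  by monotone exhaustion. The range may be a proper subset of the line (the posterior mean of a
  bounded input is bounded), hence the indicator.\<close>

lemma nn_integral_substitution_increasing:
  fixes g g' :: "real \<Rightarrow> real" and f :: "real \<Rightarrow> ennreal"
  assumes f[measurable]: "f \<in> borel_measurable borel"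
    and deriv: "\<And>x. (g has_real_derivative g' x) (at x)"
    and cont: "continuous_on UNIV g'"
    and pos: "\<And>x. 0 < g' x"
  shows "(\<integral>\<^sup>+z. f z * indicator (range g) z \<partial>lborel) = (\<integral>\<^sup>+x. f (g x) * ennreal (g' x) \<partial>lborel)"
proof -
  have mono: "strict_mono g"
    using deriv pos by (metis DERIV_pos_imp_increasing strict_monoI)
  have contg: "continuous_on A g" for A
    using deriv by (meson DERIV_isCont continuous_at_imp_continuous_on)
  have [measurable]: "g \<in> borel_measurable borel" "g' \<in> borel_measurable borel"
    using contg cont by (auto intro: borel_measurable_continuous_onI)
  have image: "g ` {-real n..real n} = {g (-real n)..g (real n)}" for n
  proof
    show "g ` {- real n..real n} \<subseteq> {g (- real n)..g (real n)}"
      using strict_mono_less_eq[OF mono] by auto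
    show "{g (- real n)..g (real n)} \<subseteq> g ` {- real n..real n}"
    proof
      fix z assume "z \<in> {g (- real n)..g (real n)}"
      then obtain x where "- real n \<le> x" "x \<le> real n" "g x = z"
        using IVT'[of g "-real n" z "real n"] contg by auto
      then show "z \<in> g ` {- real n..real n}" by auto
    qed
  qed
  have UN: "(\<Union>n. {-real n..real n}) = UNIV"
  proof safe
    fix x :: real
    obtain n where "\<bar>x\<bar> \<le> real n" using real_arch_simple by blast
    then show "x \<in> (\<Union>n. {-real n..real n})" by (auto intro!: exI[of _ n])
  qed simp
  then have UN': "(\<Union>n. {g (-real n)..g (real n)}) = range g"
    unfolding image[symmetric] image_UN[symmetric] by simp
  \<comment> \<open>Continuity from below of the measure with density \<open>h\<close>; it serves on
    both sides of the substitution.\<close>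
  have exhaust: "(\<integral>\<^sup>+x. h x * indicator (\<Union>n. A n) x \<partial>lborel) = (SUP n. \<integral>\<^sup>+x. h x * indicator (A n) x \<partial>lborel)"
    if [measurable]: "h \<in> borel_measurable borel" "\<And>n. A n \<in> sets borel" and "incseq A"
    for h :: "real \<Rightarrow> ennreal" and A :: "nat \<Rightarrow> real set"
  proof -
    have "emeasure (density lborel h) (\<Union>n. A n) = (SUP n. emeasure (density lborel h) (A n))"
      using that by (intro SUP_emeasure_incseq[symmetric]) auto
    then show ?thesis by (simp add: emeasure_density)
  qed
  have le: "g (- real n) \<le> g (- real m)" "g (real m) \<le> g (real n)" if "m \<le> n" for m n
    using that strict_mono_less_eq[OF mono] by auto
  have inc: "incseq (\<lambda>n. {-real n..real n})" "incseq (\<lambda>n. {g (-real n)..g (real n)})"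
    unfolding incseq_def using le by (auto simp del: atLeastatMost_subset_iff) (meson order_trans)+
  have "(\<integral>\<^sup>+z. f z * indicator (range g) z \<partial>lborel) = (SUP n. \<integral>\<^sup>+z. f z * indicator {g (-real n)..g (real n)} z \<partial>lborel)"
    unfolding UN'[symmetric] by (rule exhaust) (use inc in auto)
  also have "\<dots> = (SUP n. \<integral>\<^sup>+x. f (g x) * g' x * indicator {-real n..real n} x \<partial>lborel)"
  proof (rule SUP_cong[OF refl])
    fix n
    show "(\<integral>\<^sup>+z. f z * indicator {g (-real n)..g (real n)} z \<partial>lborel) = (\<integral>\<^sup>+x. f (g x) * g' x * indicator {-real n..real n} x \<partial>lborel)"
    \<comment> \<open>For \<open>n = 0\<close> the interval is a single point and both integrals
      vanish; the compact substitution rule is applied to nondegenerate intervals.\<close>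
    proof (cases "n = 0")
      case True
      then show ?thesis
        by simp
    next
      case False
      show ?thesis
        by (rule nn_integral_substitution_aux)
          (use False deriv pos cont in \<open>auto intro: less_imp_le continuous_on_subset\<close>)
    qed
  qed
  also have "\<dots> = (\<integral>\<^sup>+x. f (g x) * g' x * indicator (\<Union>n. {-real n..real n}) x \<partial>lborel)"
    by (rule exhaust[symmetric]) (use inc in auto)
  finally show ?thesis by (simp add: UN)
qed

text \<open>Change of variables for densities. Knowing \<open>r\<close> along \<open>g\<close>
  suffices later, since the entropy is computed from \<open>r (g (Y \<omega>))\<close>.\<close>

lemma distributed_increasing_image:
  fixes Y :: "'a \<Rightarrow> real" and g g' q :: "real \<Rightarrow> real"
  assumes Y: "distributed M lborel Y (\<lambda>x. ennreal (q x))"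
    and q[measurable]: "q \<in> borel_measurable borel" and q_nn: "\<And>x. 0 \<le> q x"
    and deriv: "\<And>x. (g has_real_derivative g' x) (at x)"
    and cont: "continuous_on UNIV g'"
    and pos: "\<And>x. 0 < g' x"
  obtains r where "distributed M lborel (\<lambda>\<omega>. g (Y \<omega>)) (\<lambda>x. ennreal (r x))"
    "\<And>x. 0 \<le> r x" "\<And>x. r (g x) = q x / g' x"
proof
  have mono: "strict_mono g"
    using deriv pos by (metis DERIV_pos_imp_increasing strict_monoI)
  have contg: "continuous_on A g" for A
    using deriv by (meson DERIV_isCont continuous_at_imp_continuous_on)
  have [measurable]: "g \<in> borel_measurable borel" "g' \<in> borel_measurable borel"
    using contg cont by (auto intro: borel_measurable_continuous_onI)
  \<comment> \<open>An injective continuous map of the line is open, which makes the range a Borel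
    set.\<close>
  have "open (range g)"
    using contg mono by (intro injective_into_1d_imp_open_map_UNIV[of UNIV])
      (auto simp: strict_mono_imp_inj_on)
  then have [measurable]: "range g \<in> sets borel" by simp
  define ginv where "ginv z = (if z \<in> range g then inv g z else 0)" for z
  have ginv: "ginv (g x) = x" for x
    using mono by (simp add: ginv_def strict_mono_imp_inj_on)
  have [measurable]: "ginv \<in> borel_measurable borel"
  proof (rule borel_measurableI_le)
    fix a
    \<comment> \<open>On the range, monotonicity turns the condition into
      \<open>z \<le> g a\<close>; off the range the default value 0 satisfies it exactly when
      \<open>0 \<le> a\<close>.\<close>
    have "{z. ginv z \<le> a} = (range g \<inter> {..g a}) \<union> (if 0 \<le> a then - range g else {})"
      using ginv strict_mono_less_eq[OF mono] by (auto simp: ginv_def split: if_splits)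
    also have "\<dots> \<in> sets borel" by auto
    finally show "{z \<in> space borel. ginv z \<le> a} \<in> sets borel" by simp
  qed
  define r where "r z = indicator (range g) z * (q (ginv z) / g' (ginv z))" for z
  show "0 \<le> r x" for x
    using q_nn pos by (simp add: r_def less_imp_le)
  show "r (g x) = q x / g' x" for x
    by (simp add: r_def ginv)
  have [measurable]: "r \<in> borel_measurable borel"
    unfolding r_def by measurable
  have [measurable]: "Y \<in> borel_measurable M"
    using distributed_measurable[OF Y] by simp
  have "emeasure (distr M lborel (\<lambda>\<omega>. g (Y \<omega>))) A = emeasure (density lborel r) A"
    if [measurable]: "A \<in> sets borel" for A
  proof -
    have "emeasure (distr M lborel (\<lambda>\<omega>. g (Y \<omega>))) A = (\<integral>\<^sup>+\<omega>. indicator A (g (Y \<omega>)) \<partial>M)"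
      by (subst nn_integral_indicator[symmetric]) (auto simp: nn_integral_distr simp del: nn_integral_indicator)
    also have "\<dots> = (\<integral>\<^sup>+x. ennreal (q x) * indicator A (g x) \<partial>lborel)"
      by (rule distributed_nn_integral[OF Y, symmetric]) simp
    also have "\<dots> = (\<integral>\<^sup>+x. ennreal (r (g x)) * indicator A (g x) * ennreal (g' x) \<partial>lborel)"
    proof (rule nn_integral_cong)
      fix x
      have "ennreal (q x) = ennreal (r (g x)) * ennreal (g' x)"
        using pos[of x] q_nn[of x] by (simp add: r_def ginv ennreal_mult'[symmetric])
      then show "ennreal (q x) * indicator A (g x) = ennreal (r (g x)) * indicator A (g x) * ennreal (g' x)"
        by (simp add: ac_simps)
    qed
    also have "\<dots> = (\<integral>\<^sup>+z. ennreal (r z) * indicator A z * indicator (range g) z \<partial>lborel)"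
      by (rule nn_integral_substitution_increasing[symmetric, OF _ deriv cont pos]) simp
    also have "\<dots> = (\<integral>\<^sup>+z. ennreal (r z) * indicator A z \<partial>lborel)"
      by (intro nn_integral_cong) (auto simp: r_def indicator_def)
    also have "\<dots> = emeasure (density lborel r) A"
      by (simp add: emeasure_density)
    finally show ?thesis .
  qed
  then show "distributed M lborel (\<lambda>\<omega>. g (Y \<omega>)) (\<lambda>x. ennreal (r x))"
    unfolding distributed_def by (auto intro!: measure_eqI)
qed

section \<open>Entropy as an expectation\<close>

text \<open>Moves entropies to the sample space, where logarithms of densities of different
  variables can be added and compared pointwise.\<close>

lemma (in prob_space) diff_entropy_eq_expectation:
  assumes "distributed M lborel Z (\<lambda>x. ennreal (f x))" and "\<And>x. 0 \<le> f x"
  shows "diff_entropy M Z = - (\<integral>\<omega>. ln (f (Z \<omega>)) \<partial>M)"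
proof -
  have [measurable]: "f \<in> borel_measurable borel"
    using distributed_real_measurable[OF _ assms(1)] assms(2) by simp
  interpret information_space M "exp 1"
    by standard simp
  have "diff_entropy M Z = - (\<integral>x. f x * ln (f x) \<partial>lborel)"
    unfolding diff_entropy_def using assms by (subst entropy_distr) (auto simp: log_def)
  also have "(\<integral>x. f x * ln (f x) \<partial>lborel) = (\<integral>\<omega>. ln (f (Z \<omega>)) \<partial>M)"
    using assms by (intro distributed_integral) auto
  finally show ?thesis .
qed

lemma (in prob_space) integrable_ln_density_iff:
  assumes "distributed M lborel Z (\<lambda>x. ennreal (f x))" and "\<And>x. 0 \<le> f x"
  shows "integrable lborel (\<lambda>x. f x * ln (f x)) \<longleftrightarrow> integrable M (\<lambda>\<omega>. ln (f (Z \<omega>)))"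
proof -
  have [measurable]: "f \<in> borel_measurable borel"
    using distributed_real_measurable[OF _ assms(1)] assms(2) by simp
  show ?thesis
    using assms by (intro distributed_integrable) auto
qed

text \<open>Finiteness of the entropy depends on the law alone. A conditional expectation is fixed
  only up to null sets, so this allows the version \<open>post_mean (Y \<omega>)\<close> to replace
  it.\<close>

lemma has_finite_diff_entropy_cong_AE:
  assumes "AE \<omega> in M. Y \<omega> = Z \<omega>" "Y \<in> borel_measurable M" "Z \<in> borel_measurable M"
  shows "has_finite_diff_entropy M Y \<longleftrightarrow> has_finite_diff_entropy M Z"
  using distr_cong_AE[of M M lborel lborel Y Z] assms
  by (simp add: has_finite_diff_entropy_def distributed_def)

lemma diff_entropy_cong_AE:
  assumes "prob_space M"
    and "AE \<omega> in M. Y \<omega> = Z \<omega>" "Y \<in> borel_measurable M" "Z \<in> borel_measurable M"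
  shows "diff_entropy M Y = diff_entropy M Z"
  using distr_cong_AE[of M M lborel lborel Y Z] assms
  by (simp add: diff_entropy_def prob_space.entropy_def)

lemma ln_normal_density:
  assumes "0 < v"
  shows "ln (normal_density \<mu> (sqrt v) z) = - ln (2 * pi * v) / 2 - (z - \<mu>)\<^sup>2 / v / 2"
proof -
  have "ln (normal_density \<mu> (sqrt v) z) = - ln (sqrt (2 * pi * v)) - (z - \<mu>)\<^sup>2 / v / 2"
    using assms by (simp add: normal_density_def ln_mult ln_div)
  then show ?thesis
    using assms by (simp add: ln_sqrt)
qed

section \<open>The Gaussian channel\<close>

locale gaussian_channel = prob_space M for M :: "'a measure" +
  fixes X W Y :: "'a \<Rightarrow> real" and s :: real
  assumes X[measurable]: "X \<in> borel_measurable M"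
    and integrable_X_square: "integrable M (\<lambda>\<omega>. (X \<omega>)\<^sup>2)"
    and s: "0 < s"
    and W: "distributed M lborel W (\<lambda>x. ennreal (normal_density 0 (sqrt s) x))"
    and indep: "indep_var borel X borel W"
    and Y_eq: "Y = (\<lambda>\<omega>. X \<omega> + W \<omega>)"
begin

abbreviation \<phi> :: "real \<Rightarrow> real" where "\<phi> \<equiv> normal_density 0 (sqrt s)"

text \<open>
  \<open>mom 0\<close> is the density of the output, and \<open>mom k y / mom 0 y\<close> is the \<open>k\<close>-th moment of the
  input given the output \<open>y\<close>.
\<close>

definition mom :: "nat \<Rightarrow> real \<Rightarrow> real" where
  "mom k y = (\<integral>\<omega>. X \<omega> ^ k * \<phi> (y - X \<omega>) \<partial>M)"

definition post_mean :: "real \<Rightarrow> real" where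
  "post_mean y = mom 1 y / mom 0 y"

definition post_var :: "real \<Rightarrow> real" where
  "post_var y = mom 2 y / mom 0 y - (post_mean y)\<^sup>2"

lemma W_measurable[measurable]: "W \<in> borel_measurable M"
  using distributed_measurable[OF W] by simp

lemma Y_measurable[measurable]: "Y \<in> borel_measurable M"
  unfolding Y_eq by simp

section \<open>The joint law of input and output\<close>

text \<open>Independence makes the law of input and noise a product; the shift
  \<open>w = y - x\<close> and Tonelli then exhibit \<open>\<phi> (y - x)\<close> as the density of
  the output given the input \<open>x\<close>. The input is integrated over the sample space,
  whatever its law.\<close>

lemma nn_integral_joint:
  assumes [measurable]: "case_prod h \<in> borel_measurable (borel \<Otimes>\<^sub>M borel)"
  shows "(\<integral>\<^sup>+\<omega>. h (X \<omega>) (Y \<omega>) \<partial>M) = (\<integral>\<^sup>+y. \<integral>\<^sup>+\<omega>. ennreal (\<phi> (y - X \<omega>)) * h (X \<omega>) y \<partial>M \<partial>lborel)"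
proof -
  have eq: "distr M borel X \<Otimes>\<^sub>M distr M borel W = distr M (borel \<Otimes>\<^sub>M borel) (\<lambda>x. (X x, W x))"
    using indep by (simp add: indep_var_distribution_eq)
  interpret W: prob_space "distr M borel W" by (rule prob_space_distr) simp
  interpret P: pair_sigma_finite M lborel ..
  have "(\<integral>\<^sup>+\<omega>. h (X \<omega>) (Y \<omega>) \<partial>M) = (\<integral>\<^sup>+z. h (fst z) (fst z + snd z) \<partial>distr M (borel \<Otimes>\<^sub>M borel) (\<lambda>x. (X x, W x)))"
    by (subst nn_integral_distr) (auto simp: Y_eq)
  also have "\<dots> = (\<integral>\<^sup>+x. \<integral>\<^sup>+w. h x (x + w) \<partial>distr M borel W \<partial>distr M borel X)"
    unfolding eq[symmetric] by (subst W.nn_integral_fst[symmetric]) auto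
  also have "\<dots> = (\<integral>\<^sup>+\<omega>. \<integral>\<^sup>+w. h (X \<omega>) (X \<omega> + w) \<partial>distr M borel W \<partial>M)"
    by (subst nn_integral_distr) (auto intro!: W.borel_measurable_nn_integral)
  also have "\<dots> = (\<integral>\<^sup>+\<omega>. \<integral>\<^sup>+y. ennreal (\<phi> (y - X \<omega>)) * h (X \<omega>) y \<partial>lborel \<partial>M)"
  proof (rule nn_integral_cong)
    fix \<omega>
    have "(\<integral>\<^sup>+w. h (X \<omega>) (X \<omega> + w) \<partial>distr M borel W) = (\<integral>\<^sup>+w. ennreal (\<phi> w) * h (X \<omega>) (X \<omega> + w) \<partial>lborel)"
      by (subst distributed_nn_integral[OF W]) (auto simp: nn_integral_distr)
    also have "\<dots> = (\<integral>\<^sup>+y. ennreal (\<phi> (y - X \<omega>)) * h (X \<omega>) y \<partial>lborel)"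
      by (subst nn_integral_real_affine[where c=1 and t="- X \<omega>"]) auto
    finally show "(\<integral>\<^sup>+w. h (X \<omega>) (X \<omega> + w) \<partial>distr M borel W) = \<dots>" .
  qed
  also have "\<dots> = (\<integral>\<^sup>+y. \<integral>\<^sup>+\<omega>. ennreal (\<phi> (y - X \<omega>)) * h (X \<omega>) y \<partial>M \<partial>lborel)"
    by (rule P.Fubini'[symmetric]) simp
  finally show ?thesis .
qed

text \<open>The same formula as an equality of measures, from which Bochner integrals of signed
  functions can be transferred.\<close>

lemma distr_joint:
  "distr M (borel \<Otimes>\<^sub>M borel) (\<lambda>\<omega>. (X \<omega>, Y \<omega>)) =
    distr (density (M \<Otimes>\<^sub>M lborel) (\<lambda>(\<omega>, y). ennreal (\<phi> (y - X \<omega>)))) (borel \<Otimes>\<^sub>M borel) (\<lambda>(\<omega>, y). (X \<omega>, y))"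
proof (rule measure_eqI)
  interpret P: pair_sigma_finite M lborel ..
  fix A assume "A \<in> sets (distr M (borel \<Otimes>\<^sub>M borel) (\<lambda>\<omega>. (X \<omega>, Y \<omega>)))"
  then have [measurable]: "A \<in> sets (borel \<Otimes>\<^sub>M borel)" by simp
  have "emeasure (distr M (borel \<Otimes>\<^sub>M borel) (\<lambda>\<omega>. (X \<omega>, Y \<omega>))) A = (\<integral>\<^sup>+\<omega>. indicator A (X \<omega>, Y \<omega>) \<partial>M)"
    by (subst nn_integral_indicator[symmetric]) (auto simp: nn_integral_distr simp del: nn_integral_indicator)
  also have "\<dots> = (\<integral>\<^sup>+y. \<integral>\<^sup>+\<omega>. ennreal (\<phi> (y - X \<omega>)) * indicator A (X \<omega>, y) \<partial>M \<partial>lborel)"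
    by (subst nn_integral_joint) auto
  also have "\<dots> = (\<integral>\<^sup>+z. (case z of (\<omega>, y) \<Rightarrow> ennreal (\<phi> (y - X \<omega>)) * indicator A (X \<omega>, y)) \<partial>(M \<Otimes>\<^sub>M lborel))"
    by (subst P.nn_integral_snd[symmetric]) auto
  also have "\<dots> = emeasure (distr (density (M \<Otimes>\<^sub>M lborel) (\<lambda>(\<omega>, y). ennreal (\<phi> (y - X \<omega>)))) (borel \<Otimes>\<^sub>M borel) (\<lambda>(\<omega>, y). (X \<omega>, y))) A"
    by (subst nn_integral_indicator[symmetric], simp,
        auto simp: nn_integral_distr nn_integral_density split_beta' simp del: nn_integral_indicator)
  finally show "emeasure (distr M (borel \<Otimes>\<^sub>M borel) (\<lambda>\<omega>. (X \<omega>, Y \<omega>))) A = \<dots>" .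
qed simp

text \<open>Signed counterpart of \<open>nn_integral_joint\<close>, left on the product space so
  that Fubini can be applied once integrability is known.\<close>

lemma
  fixes k :: "real \<Rightarrow> real \<Rightarrow> real"
  assumes [measurable]: "case_prod k \<in> borel_measurable (borel \<Otimes>\<^sub>M borel)"
  shows integral_joint:
      "(\<integral>\<omega>. k (X \<omega>) (Y \<omega>) \<partial>M) = (\<integral>(\<omega>, y). \<phi> (y - X \<omega>) * k (X \<omega>) y \<partial>(M \<Otimes>\<^sub>M lborel))"
    and integrable_joint_iff:
      "integrable M (\<lambda>\<omega>. k (X \<omega>) (Y \<omega>)) \<longleftrightarrow> integrable (M \<Otimes>\<^sub>M lborel) (\<lambda>(\<omega>, y). \<phi> (y - X \<omega>) * k (X \<omega>) y)"
proof -
  have "(\<integral>\<omega>. k (X \<omega>) (Y \<omega>) \<partial>M) = (\<integral>z. k (fst z) (snd z) \<partial>distr M (borel \<Otimes>\<^sub>M borel) (\<lambda>\<omega>. (X \<omega>, Y \<omega>)))"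
    by (subst integral_distr) auto
  then show "(\<integral>\<omega>. k (X \<omega>) (Y \<omega>) \<partial>M) = (\<integral>(\<omega>, y). \<phi> (y - X \<omega>) * k (X \<omega>) y \<partial>(M \<Otimes>\<^sub>M lborel))"
    unfolding distr_joint by (subst (asm) integral_distr) (auto simp: integral_density split_beta')
  have "integrable M (\<lambda>\<omega>. k (X \<omega>) (Y \<omega>)) \<longleftrightarrow> integrable (distr M (borel \<Otimes>\<^sub>M borel) (\<lambda>\<omega>. (X \<omega>, Y \<omega>))) (\<lambda>z. k (fst z) (snd z))"
    by (subst integrable_distr_eq) auto
  then show "integrable M (\<lambda>\<omega>. k (X \<omega>) (Y \<omega>)) \<longleftrightarrow> integrable (M \<Otimes>\<^sub>M lborel) (\<lambda>(\<omega>, y). \<phi> (y - X \<omega>) * k (X \<omega>) y)"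
    unfolding distr_joint by (subst (asm) integrable_distr_eq) (auto simp: integrable_density split_beta')
qed

section \<open>Regularity of the moment functions\<close>

lemma integrable_X: "integrable M X"
  using integrable_X_square by (rule square_integrable_imp_integrable[rotated]) simp

lemma integrable_X_power: "k \<le> 2 \<Longrightarrow> integrable M (\<lambda>\<omega>. X \<omega> ^ k)"
  using integrable_X integrable_X_square by (cases "k = 0"; cases "k = 1") (auto simp: le_Suc_eq numeral_2_eq_2)

lemma \<phi>_bound: "\<phi> u \<le> 1 / sqrt (2 * pi * s)"
  using s by (simp add: normal_density_def divide_right_mono)

lemma \<phi>_deriv: "(\<phi> has_real_derivative (- u / s * \<phi> u)) (at u)"
  using s unfolding normal_density_def
  by (auto intro!: derivative_eq_intros simp: field_simps)

text \<open>A bound uniform in \<open>u\<close>, to dominate the differentiated kernel. The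
  arithmetic-geometric mean inequality gives
  \<open>\<bar>u\<bar> \<le> s / 2 + u\<^sup>2 / (2 * s)\<close>, and
  \<open>1 + t \<le> exp t\<close> lets the Gaussian factor absorb the square.\<close>

lemma \<phi>_deriv_bound: "\<bar>u / s * \<phi> u\<bar> \<le> (s / 2 + 1) / (s * sqrt (2 * pi * s))"
proof -
  have "2 * s * \<bar>u\<bar> \<le> s\<^sup>2 + u\<^sup>2"
    using sum_squares_bound[of s "\<bar>u\<bar>"] by simp
  then have "\<bar>u\<bar> \<le> s / 2 + u\<^sup>2 / (2 * s)"
    using s by (simp add: field_simps power2_eq_square)
  also have "\<dots> \<le> (s / 2 + 1) * (1 + u\<^sup>2 / (2 * s))"
    using s by (simp add: field_simps)
  also have "\<dots> \<le> (s / 2 + 1) * exp (u\<^sup>2 / (2 * s))"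
    using s by (intro mult_left_mono exp_ge_add_one_self) auto
  finally have "\<bar>u\<bar> * exp (- (u\<^sup>2 / (2 * s))) \<le> s / 2 + 1"
    by (simp add: exp_minus field_simps)
  then have "\<bar>u\<bar> * exp (- (u\<^sup>2 / (2 * s))) / (s * sqrt (2 * pi * s)) \<le> (s / 2 + 1) / (s * sqrt (2 * pi * s))"
    using s by (intro divide_right_mono) auto
  then show ?thesis
    using s by (simp add: normal_density_def abs_mult)
qed

lemma integrable_mom:
  assumes "k \<le> 2"
  shows "integrable M (\<lambda>\<omega>. X \<omega> ^ k * \<phi> (y - X \<omega>))"
proof (rule Bochner_Integration.integrable_bound)
  show "integrable M (\<lambda>\<omega>. X \<omega> ^ k * (1 / sqrt (2 * pi * s)))"
    using integrable_X_power[OF assms] by simp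
  show "AE \<omega> in M. norm (X \<omega> ^ k * \<phi> (y - X \<omega>)) \<le> norm (X \<omega> ^ k * (1 / sqrt (2 * pi * s)))"
    using \<phi>_bound s unfolding norm_mult by (intro AE_I2 mult_left_mono) auto
qed simp

lemma isCont_mom: "k \<le> 2 \<Longrightarrow> isCont (mom k) y"
  unfolding mom_def
proof (rule isCont_integral_dominated)
  show "isCont (\<lambda>y. X \<omega> ^ k * \<phi> (y - X \<omega>)) y" for y \<omega>
    unfolding normal_density_def using s by (intro continuous_intros) auto
  show "\<bar>X \<omega> ^ k * \<phi> (y - X \<omega>)\<bar> \<le> \<bar>X \<omega> ^ k\<bar> * (1 / sqrt (2 * pi * s))" for \<omega> y
    using \<phi>_bound s unfolding abs_mult by (intro mult_left_mono) auto
  show "integrable M (\<lambda>\<omega>. \<bar>X \<omega> ^ k\<bar> * (1 / sqrt (2 * pi * s)))" if "k \<le> 2"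
    using integrable_X_power[OF that] by auto
qed auto

text \<open>In \<open>y\<close> the kernel \<open>\<phi> (y - x)\<close> has derivative
  \<open>(x - y) / s * \<phi> (y - x)\<close>, so differentiating raises the moment by one; two
  available moments of the input explain \<open>k \<le> 1\<close>.\<close>

lemma mom_deriv:
  assumes "k \<le> 1"
  shows "(mom k has_real_derivative (mom (Suc k) y - y * mom k y) / s) (at y)"
proof -
  let ?B = "(s / 2 + 1) / (s * sqrt (2 * pi * s))"
  have "((\<lambda>y. \<integral>\<omega>. X \<omega> ^ k * \<phi> (y - X \<omega>) \<partial>M) has_real_derivative
      (\<integral>\<omega>. X \<omega> ^ k * (- (y - X \<omega>) / s * \<phi> (y - X \<omega>)) \<partial>M)) (at y)"
  proof (rule has_real_derivative_integral_dominated)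
    show "((\<lambda>y. X \<omega> ^ k * \<phi> (y - X \<omega>)) has_real_derivative
        X \<omega> ^ k * (- (y - X \<omega>) / s * \<phi> (y - X \<omega>))) (at y)" for y \<omega>
      by (auto intro!: derivative_eq_intros DERIV_chain2[OF \<phi>_deriv])
    show "\<bar>X \<omega> ^ k * (- (y - X \<omega>) / s * \<phi> (y - X \<omega>))\<bar> \<le> \<bar>X \<omega> ^ k\<bar> * ?B" for \<omega> y
      using \<phi>_deriv_bound[of "y - X \<omega>"] unfolding abs_mult[of "X \<omega> ^ k"]
      by (intro mult_left_mono) (auto simp: abs_mult abs_minus_commute)
    show "integrable M (\<lambda>\<omega>. \<bar>X \<omega> ^ k\<bar> * ?B)"
      using integrable_X_power[of k] assms by auto
    show "integrable M (\<lambda>\<omega>. X \<omega> ^ k * \<phi> (y - X \<omega>))" for y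
      using integrable_mom[of k] assms by simp
  qed simp
  also have "(\<integral>\<omega>. X \<omega> ^ k * (- (y - X \<omega>) / s * \<phi> (y - X \<omega>)) \<partial>M)
      = (\<integral>\<omega>. (X \<omega> ^ Suc k * \<phi> (y - X \<omega>) - y * (X \<omega> ^ k * \<phi> (y - X \<omega>))) / s \<partial>M)"
    by (intro Bochner_Integration.integral_cong refl) (simp add: field_simps)
  also have "\<dots> = (mom (Suc k) y - y * mom k y) / s"
    using integrable_mom[of k y] integrable_mom[of "Suc k" y] assms by (simp add: mom_def)
  finally show ?thesis
    unfolding mom_def[abs_def] by simp
qed

text \<open>Jensen's inequality for \<open>exp\<close>. Beyond positivity, it bounds the logarithm
  of the output density below by a quadratic in \<open>y\<close>, which a second moment
  controls.\<close>

lemma mom_0_lower_bound: "exp (- (\<integral>\<omega>. (y - X \<omega>)\<^sup>2 \<partial>M) / (2 * s)) / sqrt (2 * pi * s) \<le> mom 0 y"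
proof -
  have int: "integrable M (\<lambda>\<omega>. (y - X \<omega>)\<^sup>2)"
    using integrable_X integrable_X_square unfolding power2_diff by auto
  have *: "\<phi> (y - X \<omega>) = exp (- (y - X \<omega>)\<^sup>2 / (2 * s)) / sqrt (2 * pi * s)" for \<omega>
    using s by (simp add: normal_density_def)
  have "integrable M (\<lambda>\<omega>. \<phi> (y - X \<omega>) * sqrt (2 * pi * s))"
    using integrable_mom[of 0 y] by simp
  then have int': "integrable M (\<lambda>\<omega>. exp (- (y - X \<omega>)\<^sup>2 / (2 * s)))"
    using s by (simp add: *)
  have "exp (\<integral>\<omega>. - (y - X \<omega>)\<^sup>2 / (2 * s) \<partial>M) \<le> (\<integral>\<omega>. exp (- (y - X \<omega>)\<^sup>2 / (2 * s)) \<partial>M)"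
    by (rule jensens_inequality[where I=UNIV]) (use int int' exp_convex in auto)
  then show ?thesis
    using s by (simp add: mom_def * divide_right_mono)
qed

lemma mom_0_pos: "0 < mom 0 y"
  by (rule less_le_trans[OF _ mom_0_lower_bound]) (use s in simp)

lemma mom_0_upper_bound: "mom 0 y \<le> 1 / sqrt (2 * pi * s)"
proof -
  have "mom 0 y \<le> (\<integral>\<omega>. 1 / sqrt (2 * pi * s) \<partial>M)"
    unfolding mom_def using integrable_mom[of 0 y] \<phi>_bound by (intro integral_mono) auto
  then show ?thesis by (simp add: prob_space)
qed

lemma mom_measurable[measurable]:
  "mom 0 \<in> borel_measurable borel" "mom 1 \<in> borel_measurable borel" "mom 2 \<in> borel_measurable borel"
  using isCont_mom by (auto intro!: borel_measurable_continuous_onI continuous_at_imp_continuous_on)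

lemma post_mean_measurable[measurable]: "post_mean \<in> borel_measurable borel"
  unfolding post_mean_def[abs_def] by measurable

lemma post_var_measurable[measurable]: "post_var \<in> borel_measurable borel"
  unfolding post_var_def[abs_def] by measurable

section \<open>The output density and the posterior moments\<close>

text \<open>The joint formula for a test function of \<open>y\<close> alone.\<close>

lemma Y_distributed: "distributed M lborel Y (\<lambda>y. ennreal (mom 0 y))"
  unfolding distributed_def
proof (intro conjI measure_eqI)
  fix A assume "A \<in> sets (distr M lborel Y)"
  then have [measurable]: "A \<in> sets borel" by simp
  have "emeasure (distr M lborel Y) A = (\<integral>\<^sup>+\<omega>. indicator A (Y \<omega>) \<partial>M)"
    by (subst nn_integral_indicator[symmetric]) (auto simp: nn_integral_distr simp del: nn_integral_indicator)
  also have "\<dots> = (\<integral>\<^sup>+y. \<integral>\<^sup>+\<omega>. ennreal (\<phi> (y - X \<omega>)) * indicator A y \<partial>M \<partial>lborel)"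
    by (subst nn_integral_joint) auto
  also have "\<dots> = (\<integral>\<^sup>+y. ennreal (mom 0 y) * indicator A y \<partial>lborel)"
  proof (rule nn_integral_cong)
    fix y
    have "(\<integral>\<^sup>+\<omega>. ennreal (\<phi> (y - X \<omega>)) \<partial>M) = ennreal (mom 0 y)"
      unfolding mom_def using integrable_mom[of 0 y] by (subst nn_integral_eq_integral) auto
    then show "(\<integral>\<^sup>+\<omega>. ennreal (\<phi> (y - X \<omega>)) * indicator A y \<partial>M) = ennreal (mom 0 y) * indicator A y"
      by (simp add: nn_integral_multc)
  qed
  also have "\<dots> = emeasure (density lborel (mom 0)) A"
    by (simp add: emeasure_density)
  finally show "emeasure (distr M lborel Y) A = \<dots>" .
qed auto

lemma post_mean_deriv: "(post_mean has_real_derivative post_var y / s) (at y)"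
proof -
  have "(post_mean has_real_derivative
      ((mom 2 y - y * mom 1 y) / s * mom 0 y - mom 1 y * ((mom 1 y - y * mom 0 y) / s)) / (mom 0 y * mom 0 y)) (at y)"
    unfolding post_mean_def[abs_def] using mom_deriv[of 0 y] mom_deriv[of 1 y] mom_0_pos[of y]
    by (intro DERIV_divide) (auto simp: numeral_2_eq_2)
  \<comment> \<open>The two terms carrying the factor \<open>y\<close> cancel, leaving the
    variance.\<close>
  also have "((mom 2 y - y * mom 1 y) / s * mom 0 y - mom 1 y * ((mom 1 y - y * mom 0 y) / s)) / (mom 0 y * mom 0 y)
      = post_var y / s"
    using mom_0_pos[of y] s by (simp add: post_var_def post_mean_def field_simps power2_eq_square)
  finally show ?thesis .
qed

lemma continuous_post_var: "continuous_on UNIV post_var"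
  unfolding post_var_def[abs_def] post_mean_def[abs_def] using isCont_mom mom_0_pos
  by (intro continuous_at_imp_continuous_on ballI continuous_intros) (auto simp: less_imp_neq[symmetric])

text \<open>Expanding the square identifies \<open>post_var y\<close>, defined through raw moments,
  as a centered second moment with the weight
  \<open>\<phi> (y - X \<omega>) / mom 0 y\<close>.\<close>

lemma
  shows integrable_centered_second_moment: "integrable M (\<lambda>\<omega>. \<phi> (y - X \<omega>) * (X \<omega> - post_mean y)\<^sup>2)"
    and integral_centered_second_moment:
      "(\<integral>\<omega>. \<phi> (y - X \<omega>) * (X \<omega> - post_mean y)\<^sup>2 \<partial>M) = mom 0 y * post_var y"
proof -
  have *: "\<phi> (y - X \<omega>) * (X \<omega> - post_mean y)\<^sup>2 = X \<omega> ^ 2 * \<phi> (y - X \<omega>)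
      - 2 * post_mean y * (X \<omega> ^ 1 * \<phi> (y - X \<omega>)) + (post_mean y)\<^sup>2 * (X \<omega> ^ 0 * \<phi> (y - X \<omega>))" for \<omega>
    by (simp add: power2_diff algebra_simps)
  note int = integrable_mom[of 0 y] integrable_mom[of 1 y] integrable_mom[of 2 y]
  show "integrable M (\<lambda>\<omega>. \<phi> (y - X \<omega>) * (X \<omega> - post_mean y)\<^sup>2)"
    unfolding * using int by (intro Bochner_Integration.integrable_add Bochner_Integration.integrable_diff integrable_mult_right) auto
  have "(\<integral>\<omega>. \<phi> (y - X \<omega>) * (X \<omega> - post_mean y)\<^sup>2 \<partial>M)
      = mom 2 y - 2 * post_mean y * mom 1 y + (post_mean y)\<^sup>2 * mom 0 y"
    unfolding * mom_def using int
    by (subst Bochner_Integration.integral_add Bochner_Integration.integral_diff;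
        (intro Bochner_Integration.integrable_diff integrable_mult_right)?; simp)+
  also have "\<dots> = mom 0 y * post_var y"
    using mom_0_pos[of y] by (simp add: post_var_def post_mean_def field_simps power2_eq_square)
  finally show "(\<integral>\<omega>. \<phi> (y - X \<omega>) * (X \<omega> - post_mean y)\<^sup>2 \<partial>M) = mom 0 y * post_var y" .
qed

section \<open>Conditional mean and conditional variance\<close>

lemma finite_measure_subalgebra_Y: "finite_measure_subalgebra M (vimage_algebra (space M) Y borel)"
proof
  show "subalgebra M (vimage_algebra (space M) Y borel)"
    unfolding subalgebra_def sets_vimage_algebra2[of Y "space M" borel, simplified]
    by auto
qed

text \<open>Bayes' formula: if \<open>K y\<close> is the posterior average of \<open>k x y\<close>,
  then \<open>K (Y \<omega>)\<close> is a version of the conditional expectation. Events of the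
  generated algebra are preimages of Borel sets \<open>B\<close>, and Fubini integrates out the
  input first, where \<open>indicator B y\<close> is constant.\<close>

lemma cond_exp_given_joint:
  fixes k :: "real \<Rightarrow> real \<Rightarrow> real"
  assumes k[measurable]: "case_prod k \<in> borel_measurable (borel \<Otimes>\<^sub>M borel)"
    and int: "integrable M (\<lambda>\<omega>. k (X \<omega>) (Y \<omega>))"
    and K[measurable]: "K \<in> borel_measurable borel"
    and K_eq: "\<And>y. (\<integral>\<omega>. \<phi> (y - X \<omega>) * k (X \<omega>) y \<partial>M) = mom 0 y * K y"
  shows "AE \<omega> in M. cond_exp_given M Y (\<lambda>\<omega>. k (X \<omega>) (Y \<omega>)) \<omega> = K (Y \<omega>)"
    and "integrable M (\<lambda>\<omega>. K (Y \<omega>))"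
proof -
  interpret P: pair_sigma_finite M lborel ..
  let ?F = "vimage_algebra (space M) Y borel"
  interpret F: finite_measure_subalgebra M ?F
    by (rule finite_measure_subalgebra_Y)
  have joint: "integrable (M \<Otimes>\<^sub>M lborel) (\<lambda>(\<omega>, y). \<phi> (y - X \<omega>) * k (X \<omega>) y)"
    using int integrable_joint_iff[OF k] by simp
  have "integrable lborel (\<lambda>y. \<integral>\<omega>. \<phi> (y - X \<omega>) * k (X \<omega>) y \<partial>M)"
    using P.integrable_snd[OF joint] by simp
  then show intK: "integrable M (\<lambda>\<omega>. K (Y \<omega>))"
    unfolding K_eq using distributed_integrable[OF Y_distributed] mom_0_pos
    by (auto simp: less_imp_le)
  show "AE \<omega> in M. cond_exp_given M Y (\<lambda>\<omega>. k (X \<omega>) (Y \<omega>)) \<omega> = K (Y \<omega>)"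
    unfolding cond_exp_given_def
  proof (rule F.real_cond_exp_charact)
    fix A assume "A \<in> sets ?F"
    then obtain B where [measurable]: "B \<in> sets borel" and A: "A = Y -` B \<inter> space M"
      by (auto simp: sets_vimage_algebra2)
    have ind: "indicator A \<omega> = (indicator B (Y \<omega>) :: real)" if "\<omega> \<in> space M" for \<omega>
      using that by (auto simp: A indicator_def)
    have [measurable]: "case_prod (\<lambda>x y. indicator B y * k x y) \<in> borel_measurable (borel \<Otimes>\<^sub>M borel)"
      by measurable
    have intB: "integrable M (\<lambda>\<omega>. indicator B (Y \<omega>) * k (X \<omega>) (Y \<omega>))"
      by (rule Bochner_Integration.integrable_bound[OF int]) (auto simp: indicator_def)
    have "(\<integral>\<omega>\<in>A. k (X \<omega>) (Y \<omega>) \<partial>M) = (\<integral>\<omega>. indicator B (Y \<omega>) * k (X \<omega>) (Y \<omega>) \<partial>M)"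
      unfolding set_lebesgue_integral_def by (intro Bochner_Integration.integral_cong) (auto simp: ind)
    also have "\<dots> = (\<integral>(\<omega>, y). \<phi> (y - X \<omega>) * (indicator B y * k (X \<omega>) y) \<partial>(M \<Otimes>\<^sub>M lborel))"
      by (rule integral_joint) simp
    also have "\<dots> = (\<integral>y. \<integral>\<omega>. \<phi> (y - X \<omega>) * (indicator B y * k (X \<omega>) y) \<partial>M \<partial>lborel)"
      using intB integrable_joint_iff[of "\<lambda>x y. indicator B y * k x y"]
      by (subst P.integral_snd) auto
    also have "\<dots> = (\<integral>y. mom 0 y * (indicator B y * K y) \<partial>lborel)"
    proof (rule Bochner_Integration.integral_cong[OF refl])
      fix y
      have "(\<integral>\<omega>. \<phi> (y - X \<omega>) * (indicator B y * k (X \<omega>) y) \<partial>M)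
          = (\<integral>\<omega>. indicator B y * (\<phi> (y - X \<omega>) * k (X \<omega>) y) \<partial>M)"
        by (simp add: ac_simps)
      also have "\<dots> = mom 0 y * (indicator B y * K y)"
        using K_eq[of y] by simp
      finally show "(\<integral>\<omega>. \<phi> (y - X \<omega>) * (indicator B y * k (X \<omega>) y) \<partial>M) = \<dots>" .
    qed
    also have "\<dots> = (\<integral>\<omega>. indicator B (Y \<omega>) * K (Y \<omega>) \<partial>M)"
      using mom_0_pos by (intro distributed_integral[OF Y_distributed]) (auto simp: less_imp_le)
    also have "\<dots> = (\<integral>\<omega>\<in>A. K (Y \<omega>) \<partial>M)"
      unfolding set_lebesgue_integral_def by (intro Bochner_Integration.integral_cong) (auto simp: ind)
    finally show "(\<integral>\<omega>\<in>A. k (X \<omega>) (Y \<omega>) \<partial>M) = (\<integral>\<omega>\<in>A. K (Y \<omega>) \<partial>M)" .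
  next
    have "Y \<in> measurable ?F borel"
      by (rule measurable_vimage_algebra1) simp
    then show "(\<lambda>\<omega>. K (Y \<omega>)) \<in> borel_measurable ?F"
      by measurable
  qed (use int intK in auto)
qed

lemma cond_exp_X:
  "AE \<omega> in M. cond_exp_given M Y X \<omega> = post_mean (Y \<omega>)"
  "integrable M (\<lambda>\<omega>. post_mean (Y \<omega>))"
  using cond_exp_given_joint[of "\<lambda>x y. x" post_mean] integrable_X mom_0_pos
  by (auto simp: mom_def post_mean_def ac_simps less_imp_neq[symmetric])

lemma nn_integral_residual_square_fiber:
  "(\<integral>\<^sup>+\<omega>. ennreal (\<phi> (y - X \<omega>)) * ennreal ((X \<omega> - post_mean y)\<^sup>2) \<partial>M) = ennreal (mom 0 y * post_var y)"
  using integrable_centered_second_moment[of y]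
  by (simp add: ennreal_mult'[symmetric] nn_integral_eq_integral integral_centered_second_moment)

lemma integrable_residual_square: "integrable M (\<lambda>\<omega>. (X \<omega> - post_mean (Y \<omega>))\<^sup>2)"
proof (rule integrableI_nonneg)
  have "(\<integral>\<^sup>+\<omega>. ennreal ((X \<omega> - post_mean (Y \<omega>))\<^sup>2) \<partial>M) = (\<integral>\<^sup>+y. ennreal (mom 0 y * post_var y) \<partial>lborel)"
    by (subst nn_integral_joint) (auto simp: nn_integral_residual_square_fiber)
  \<comment> \<open>Dropping the squared mean bounds the centered second moment by the raw one,
    which integrates to the second moment of the input.\<close>
  also have "\<dots> \<le> (\<integral>\<^sup>+y. ennreal (mom 2 y) \<partial>lborel)"
    using mom_0_pos by (intro nn_integral_mono ennreal_leI) (simp add: post_var_def field_simps less_imp_le less_imp_neq[symmetric])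
  also have "\<dots> = (\<integral>\<^sup>+y. \<integral>\<^sup>+\<omega>. ennreal (\<phi> (y - X \<omega>)) * ennreal ((X \<omega>)\<^sup>2) \<partial>M \<partial>lborel)"
    unfolding mom_def using integrable_mom[of 2]
    by (intro nn_integral_cong) (simp add: ennreal_mult'[symmetric] nn_integral_eq_integral mult.commute)
  also have "\<dots> = (\<integral>\<^sup>+\<omega>. ennreal ((X \<omega>)\<^sup>2) \<partial>M)"
    by (rule nn_integral_joint[symmetric]) simp
  also have "\<dots> < \<infinity>"
    using integrable_X_square by (simp add: nn_integral_eq_integral)
  finally show "(\<integral>\<^sup>+\<omega>. ennreal ((X \<omega> - post_mean (Y \<omega>))\<^sup>2) \<partial>M) < \<infinity>" .
qed auto

lemma cond_exp_given_measurable[measurable]: "cond_exp_given M Y Z \<in> borel_measurable M"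
  unfolding cond_exp_given_def
  by (rule borel_measurable_cond_exp2)

lemma cond_var_X:
  "AE \<omega> in M. cond_var_given M Y X \<omega> = post_var (Y \<omega>)"
  "integrable M (\<lambda>\<omega>. post_var (Y \<omega>))"
proof -
  let ?F = "vimage_algebra (space M) Y borel"
  interpret F: finite_measure_subalgebra M ?F
    by (rule finite_measure_subalgebra_Y)
  note joint = cond_exp_given_joint[of "\<lambda>x y. (x - post_mean y)\<^sup>2" post_var,
      OF _ integrable_residual_square _ integral_centered_second_moment]
  show "integrable M (\<lambda>\<omega>. post_var (Y \<omega>))"
    by (rule joint(2)) auto
  have "AE \<omega> in M. cond_var_given M Y X \<omega> = cond_exp_given M Y (\<lambda>\<omega>. (X \<omega> - post_mean (Y \<omega>))\<^sup>2) \<omega>"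
    \<comment> \<open>The instantiated definition opens only the outer conditional expectations; the
      inner one stays folded so that \<open>cond_exp_X\<close> can replace it by the posterior
      mean.\<close>
    unfolding cond_var_given_def cond_exp_given_def[of M Y "\<lambda>\<omega>. (_ \<omega> - _ \<omega>)\<^sup>2"]
    by (rule F.real_cond_exp_cong) (use cond_exp_X(1) in auto)
  moreover have "AE \<omega> in M. cond_exp_given M Y (\<lambda>\<omega>. (X \<omega> - post_mean (Y \<omega>))\<^sup>2) \<omega> = post_var (Y \<omega>)"
    by (rule joint(1)) auto
  ultimately show "AE \<omega> in M. cond_var_given M Y X \<omega> = post_var (Y \<omega>)"
    by eventually_elim simp
qed

section \<open>Integrability of the logarithm of the output density\<close>

lemma W_square: "has_bochner_integral M (\<lambda>\<omega>. (W \<omega>)\<^sup>2) s"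
proof -
  have *: "has_bochner_integral lborel (\<lambda>x. \<phi> x * x\<^sup>2) s"
    using normal_moment_even[of "sqrt s" 0 1] s by simp
  show ?thesis
    using * distributed_integrable[OF W, of "\<lambda>x. x\<^sup>2"] distributed_integral[OF W, of "\<lambda>x. x\<^sup>2"]
    by (simp add: has_bochner_integral_iff)
qed

text \<open>The density is bounded above by a constant and below by the Jensen bound, so its
  logarithm is at most quadratic in the noise and the input.\<close>

lemma integrable_ln_mom_0: "integrable M (\<lambda>\<omega>. ln (mom 0 (Y \<omega>)))"
proof (rule Bochner_Integration.integrable_bound)
  let ?c = "ln (1 / sqrt (2 * pi * s))"
  have intX: "integrable M (\<lambda>\<omega>. (y - X \<omega>)\<^sup>2)" for y
    using integrable_X integrable_X_square unfolding power2_diff by auto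
  \<comment> \<open>The Jensen exponent is at most \<open>((Y \<omega>)\<^sup>2 +
    (\<integral>\<omega>. (X \<omega>)\<^sup>2 \<partial>M)) / s\<close>, and
    \<open>(Y \<omega>)\<^sup>2\<close> is at most twice the sum of the squares of noise and
    input.\<close>
  show "integrable M (\<lambda>\<omega>. \<bar>?c\<bar> + (((W \<omega>)\<^sup>2 + (X \<omega>)\<^sup>2) * 2 + (\<integral>\<omega>. (X \<omega>)\<^sup>2 \<partial>M)) / s)"
    using W_square integrable_X_square by (auto simp: has_bochner_integral_iff)
  show "AE \<omega> in M. norm (ln (mom 0 (Y \<omega>)))
      \<le> norm (\<bar>?c\<bar> + (((W \<omega>)\<^sup>2 + (X \<omega>)\<^sup>2) * 2 + (\<integral>\<omega>. (X \<omega>)\<^sup>2 \<partial>M)) / s)"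
  proof (intro AE_I2)
    fix \<omega>
    have upper: "ln (mom 0 (Y \<omega>)) \<le> ?c"
      using mom_0_upper_bound mom_0_pos s by (subst ln_le_cancel_iff) auto
    have "(\<integral>\<omega>'. (Y \<omega> - X \<omega>')\<^sup>2 \<partial>M) \<le> (\<integral>\<omega>'. 2 * (Y \<omega>)\<^sup>2 + 2 * (X \<omega>')\<^sup>2 \<partial>M)"
    proof (rule integral_mono[OF intX])
      show "(Y \<omega> - X \<omega>')\<^sup>2 \<le> 2 * (Y \<omega>)\<^sup>2 + 2 * (X \<omega>')\<^sup>2" for \<omega>'
        using zero_le_power2[of "Y \<omega> + X \<omega>'"] by (simp add: power2_sum power2_diff)
    qed (use integrable_X_square in auto)
    also have "\<dots> = 2 * (Y \<omega>)\<^sup>2 + 2 * (\<integral>\<omega>. (X \<omega>)\<^sup>2 \<partial>M)"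
      using integrable_X_square by (simp add: prob_space)
    also have "(Y \<omega>)\<^sup>2 \<le> 2 * (W \<omega>)\<^sup>2 + 2 * (X \<omega>)\<^sup>2"
      using zero_le_power2[of "X \<omega> - W \<omega>"] by (simp add: Y_eq power2_sum power2_diff)
    finally have Ysq: "(\<integral>\<omega>'. (Y \<omega> - X \<omega>')\<^sup>2 \<partial>M) / (2 * s) \<le> (((W \<omega>)\<^sup>2 + (X \<omega>)\<^sup>2) * 2 + (\<integral>\<omega>. (X \<omega>)\<^sup>2 \<partial>M)) / s"
      using s by (simp add: field_simps)
    have "ln (exp (- (\<integral>\<omega>'. (Y \<omega> - X \<omega>')\<^sup>2 \<partial>M) / (2 * s)) * (1 / sqrt (2 * pi * s))) \<le> ln (mom 0 (Y \<omega>))"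
      using mom_0_lower_bound[of "Y \<omega>"] mom_0_pos s by (subst ln_le_cancel_iff) auto
    then have "?c - (\<integral>\<omega>'. (Y \<omega> - X \<omega>')\<^sup>2 \<partial>M) / (2 * s) \<le> ln (mom 0 (Y \<omega>))"
      using s by (subst (asm) ln_mult) auto
    then show "norm (ln (mom 0 (Y \<omega>)))
        \<le> norm (\<bar>?c\<bar> + (((W \<omega>)\<^sup>2 + (X \<omega>)\<^sup>2) * 2 + (\<integral>\<omega>. (X \<omega>)\<^sup>2 \<partial>M)) / s)"
      using upper Ysq unfolding real_norm_def by linarith
  qed
qed auto

end

section \<open>Inputs of finite differential entropy\<close>

text \<open>Finite entropy is recorded on the sample space, the form used in
  \<open>gibbs_bound\<close>; \<open>integrable_ln_density_iff\<close> translates it from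
  \<open>p x * ln (p x)\<close>.\<close>

locale gaussian_channel_density = gaussian_channel +
  fixes p :: "real \<Rightarrow> real"
  assumes p: "distributed M lborel X (\<lambda>x. ennreal (p x))"
    and p_nn: "\<And>x. 0 \<le> p x"
    and p_ent: "integrable M (\<lambda>\<omega>. ln (p (X \<omega>)))"
begin

section \<open>Positivity and normalization by the posterior variance\<close>

lemma p_measurable[measurable]: "p \<in> borel_measurable borel"
  using distributed_real_measurable[OF _ p] p_nn by simp

lemma AE_p_pos: "AE \<omega> in M. 0 < p (X \<omega>)"
  by (subst distributed_AE2[OF p]) auto

text \<open>The kernel is strictly positive, so zero variance would force the input to equal
  \<open>post_mean y\<close> almost surely, whereas a law with a density does not charge
  points.\<close>

lemma post_var_pos: "0 < post_var y"
proof -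
  have "0 \<le> (\<integral>\<omega>. \<phi> (y - X \<omega>) * (X \<omega> - post_mean y)\<^sup>2 \<partial>M)"
    by simp
  moreover have "(\<integral>\<omega>. \<phi> (y - X \<omega>) * (X \<omega> - post_mean y)\<^sup>2 \<partial>M) \<noteq> 0"
  proof
    assume "(\<integral>\<omega>. \<phi> (y - X \<omega>) * (X \<omega> - post_mean y)\<^sup>2 \<partial>M) = 0"
    then have "AE \<omega> in M. \<phi> (y - X \<omega>) * (X \<omega> - post_mean y)\<^sup>2 = 0"
      using integrable_centered_second_moment[of y] by (subst (asm) integral_nonneg_eq_0_iff_AE) auto
    moreover have "AE \<omega> in M. X \<omega> \<noteq> post_mean y"
      using AE_lborel_singleton[of "post_mean y"] by (subst distributed_AE2[OF p]) auto
    ultimately have "AE \<omega> in M. False"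
      by eventually_elim (use normal_density_pos[of "sqrt s" 0] s in \<open>auto simp: less_imp_neq[symmetric]\<close>)
    then show False by simp
  qed
  ultimately show ?thesis
    unfolding integral_centered_second_moment using mom_0_pos[of y]
    by (simp add: zero_le_mult_iff)
qed

text \<open>For each output the normalized square has posterior mean 1. Working with nonnegative
  integrals yields integrability and value together.\<close>

lemma normalized_residual_square: "has_bochner_integral M (\<lambda>\<omega>. (X \<omega> - post_mean (Y \<omega>))\<^sup>2 / post_var (Y \<omega>)) 1"
proof (rule has_bochner_integral_nn_integral)
  have "(\<integral>\<^sup>+\<omega>. ennreal ((X \<omega> - post_mean (Y \<omega>))\<^sup>2 / post_var (Y \<omega>)) \<partial>M)
      = (\<integral>\<^sup>+y. \<integral>\<^sup>+\<omega>. ennreal (\<phi> (y - X \<omega>)) * ennreal ((X \<omega> - post_mean y)\<^sup>2 / post_var y) \<partial>M \<partial>lborel)"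
    by (rule nn_integral_joint) simp
  also have "\<dots> = (\<integral>\<^sup>+y. ennreal (mom 0 y) * 1 \<partial>lborel)"
  proof (rule nn_integral_cong)
    fix y
    have "(\<integral>\<^sup>+\<omega>. ennreal (\<phi> (y - X \<omega>)) * ennreal ((X \<omega> - post_mean y)\<^sup>2 / post_var y) \<partial>M)
        = (\<integral>\<^sup>+\<omega>. ennreal (\<phi> (y - X \<omega>)) * ennreal ((X \<omega> - post_mean y)\<^sup>2) * ennreal (1 / post_var y) \<partial>M)"
      using post_var_pos[of y]
      by (intro nn_integral_cong) (simp add: ennreal_mult'[symmetric] ennreal_mult''[symmetric] less_imp_le)
    also have "\<dots> = ennreal (mom 0 y * post_var y) * ennreal (1 / post_var y)"
      by (subst nn_integral_multc) (auto simp: nn_integral_residual_square_fiber)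
    also have "\<dots> = ennreal (mom 0 y) * 1"
      using post_var_pos[of y] mom_0_pos[of y] by (simp add: ennreal_mult''[symmetric])
    finally show "(\<integral>\<^sup>+\<omega>. ennreal (\<phi> (y - X \<omega>)) * ennreal ((X \<omega> - post_mean y)\<^sup>2 / post_var y) \<partial>M)
        = ennreal (mom 0 y) * 1" .
  qed
  also have "\<dots> = 1"
    using distributed_nn_integral[OF Y_distributed, of "\<lambda>_. 1"] by (simp add: emeasure_space_1)
  finally show "(\<integral>\<^sup>+\<omega>. ennreal ((X \<omega> - post_mean (Y \<omega>))\<^sup>2 / post_var (Y \<omega>)) \<partial>M) = ennreal 1"
    by simp
qed (use post_var_pos in \<open>auto simp: less_imp_le\<close>)

section \<open>The Gibbs inequality\<close>

text \<open>
  The quotient \<open>g / f\<close>, which is \<open>0\<close> where \<open>p x = 0\<close>; this is why its expectation is only bounded by 1.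
\<close>

definition ratio :: "real \<Rightarrow> real \<Rightarrow> real" where
  "ratio x y = mom 0 y * normal_density (post_mean y) (sqrt (post_var y)) x / (p x * \<phi> (y - x))"

lemma ratio_measurable[measurable]: "case_prod ratio \<in> borel_measurable (borel \<Otimes>\<^sub>M borel)"
  unfolding ratio_def normal_density_def by measurable

lemma ratio_nonneg: "0 \<le> ratio x y"
  using mom_0_pos[of y] p_nn[of x] by (simp add: ratio_def)

text \<open>Weighting by the joint density cancels the denominator; what remains for fixed
  \<open>y\<close> is at most \<open>mom 0 y\<close> times a normal density in \<open>x\<close>, of
  total mass \<open>mom 0 y\<close>.\<close>

lemma nn_integral_ratio: "(\<integral>\<^sup>+\<omega>. ennreal (ratio (X \<omega>) (Y \<omega>)) \<partial>M) \<le> 1"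
proof -
  have "(\<integral>\<^sup>+\<omega>. ennreal (ratio (X \<omega>) (Y \<omega>)) \<partial>M)
      = (\<integral>\<^sup>+y. \<integral>\<^sup>+\<omega>. ennreal (\<phi> (y - X \<omega>)) * ennreal (ratio (X \<omega>) y) \<partial>M \<partial>lborel)"
    by (rule nn_integral_joint) simp
  also have "\<dots> \<le> (\<integral>\<^sup>+y. ennreal (mom 0 y) * 1 \<partial>lborel)"
  proof (rule nn_integral_mono)
    fix y
    let ?n = "normal_density (post_mean y) (sqrt (post_var y))"
    have "(\<integral>\<^sup>+\<omega>. ennreal (\<phi> (y - X \<omega>)) * ennreal (ratio (X \<omega>) y) \<partial>M)
        = (\<integral>\<^sup>+x. ennreal (p x) * (ennreal (\<phi> (y - x)) * ennreal (ratio x y)) \<partial>lborel)"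
      by (rule distributed_nn_integral[OF p, symmetric]) simp
    also have "\<dots> \<le> (\<integral>\<^sup>+x. ennreal (mom 0 y) * ennreal (?n x) \<partial>lborel)"
    proof (rule nn_integral_mono)
      fix x
      have "\<phi> (y - x) > 0" using s by (intro normal_density_pos) simp
      then have "p x * (\<phi> (y - x) * ratio x y) \<le> mom 0 y * ?n x"
        \<comment> \<open>Equality holds when \<open>p x\<close> is nonzero; for
          \<open>p x = 0\<close> the left side is 0.\<close>
        using p_nn[of x] mom_0_pos[of y] by (cases "p x = 0") (auto simp: ratio_def)
      then show "ennreal (p x) * (ennreal (\<phi> (y - x)) * ennreal (ratio x y)) \<le> ennreal (mom 0 y) * ennreal (?n x)"
        using p_nn ratio_nonneg mom_0_pos[of y]
        by (simp add: ennreal_mult'[symmetric] less_imp_le)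
    qed
    also have "\<dots> = ennreal (mom 0 y) * 1"
      using post_var_pos[of y] by (simp add: nn_integral_cmult nn_integral_eq_integral)
    finally show "(\<integral>\<^sup>+\<omega>. ennreal (\<phi> (y - X \<omega>)) * ennreal (ratio (X \<omega>) y) \<partial>M) \<le> ennreal (mom 0 y) * 1" .
  qed
  also have "\<dots> = 1"
    using distributed_nn_integral[OF Y_distributed, of "\<lambda>_. 1"] by (simp add: emeasure_space_1)
  finally show ?thesis .
qed

lemma integrable_ratio: "integrable M (\<lambda>\<omega>. ratio (X \<omega>) (Y \<omega>))"
  using nn_integral_ratio ratio_nonneg
  by (intro integrableI_nonneg) (auto intro: le_less_trans)

lemma integral_ratio: "(\<integral>\<omega>. ratio (X \<omega>) (Y \<omega>) \<partial>M) \<le> 1"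
  using nn_integral_ratio integrable_ratio ratio_nonneg
  by (simp add: nn_integral_eq_integral)

text \<open>
  Obtained by solving \<open>ln r \<le> r - 1\<close>, with \<open>r = ratio x y\<close>, for the logarithm of the posterior variance.
\<close>

definition gibbs_bound :: "'a \<Rightarrow> real" where
  "gibbs_bound \<omega> = 2 * (ln (mom 0 (Y \<omega>)) - ln (p (X \<omega>)) + (W \<omega>)\<^sup>2 / (2 * s)
     - (X \<omega> - post_mean (Y \<omega>))\<^sup>2 / post_var (Y \<omega>) / 2 + 1 - ratio (X \<omega>) (Y \<omega>))"

text \<open>Almost surely \<open>p (X \<omega>)\<close> is positive, hence so is the ratio, and its
  logarithm splits into terms in which the variances occur only through
  \<open>ln (post_var y / s) / 2\<close>.\<close>

lemma gibbs_bound_le: "AE \<omega> in M. gibbs_bound \<omega> \<le> ln (post_var (Y \<omega>) / s)"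
  using AE_p_pos
proof eventually_elim
  fix \<omega> assume p: "0 < p (X \<omega>)"
  define x y where "x = X \<omega>" and "y = Y \<omega>"
  have W: "W \<omega> = y - x" by (simp add: x_def y_def Y_eq)
  note pos = mom_0_pos[of y] post_var_pos[of y] p[folded x_def] s
  have npos: "0 < \<phi> (y - x)" "0 < normal_density (post_mean y) (sqrt (post_var y)) x"
    using pos by (auto intro!: normal_density_pos)
  then have "0 < ratio x y"
    using pos by (simp add: ratio_def)
  then have "ln (ratio x y) \<le> ratio x y - 1"
    by (rule ln_le_minus_one)
  moreover have "ln (ratio x y) = ln (mom 0 y) - ln (2 * pi * post_var y) / 2 - (x - post_mean y)\<^sup>2 / post_var y / 2
      - ln (p x) + ln (2 * pi * s) / 2 + (y - x)\<^sup>2 / (2 * s)"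
    using pos npos by (simp add: ratio_def ln_div ln_mult ln_normal_density, simp add: field_simps)
  moreover have "ln (2 * pi * post_var y) - ln (2 * pi * s) = ln (post_var y / s)"
    using pos by (simp add: ln_div ln_mult)
  ultimately show "gibbs_bound \<omega> \<le> ln (post_var (Y \<omega>) / s)"
    unfolding gibbs_bound_def W x_def[symmetric] y_def[symmetric] by argo
qed

lemma integrable_gibbs_bound: "integrable M gibbs_bound"
  unfolding gibbs_bound_def[abs_def]
  using integrable_ln_mom_0 p_ent W_square normalized_residual_square integrable_ratio
  by (intro integrable_mult_right Bochner_Integration.integrable_add Bochner_Integration.integrable_diff
      integrable_divide_zero) (auto simp: has_bochner_integral_iff)

text \<open>The noise term has mean \<open>1 / 2\<close> and the residual term
  \<open>- 1 / 2\<close>, so they cancel; the rest, one minus the mean ratio, is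
  nonnegative.\<close>

lemma integral_gibbs_bound:
  "2 * ((\<integral>\<omega>. ln (mom 0 (Y \<omega>)) \<partial>M) - (\<integral>\<omega>. ln (p (X \<omega>)) \<partial>M)) \<le> (\<integral>\<omega>. gibbs_bound \<omega> \<partial>M)"
proof -
  note ints = integrable_ln_mom_0 p_ent integrable_ratio
    W_square[THEN integrable.intros] normalized_residual_square[THEN integrable.intros]
  have "(\<integral>\<omega>. gibbs_bound \<omega> \<partial>M) = 2 * ((\<integral>\<omega>. ln (mom 0 (Y \<omega>)) \<partial>M) - (\<integral>\<omega>. ln (p (X \<omega>)) \<partial>M)
      + (\<integral>\<omega>. (W \<omega>)\<^sup>2 \<partial>M) / (2 * s)
      - (\<integral>\<omega>. (X \<omega> - post_mean (Y \<omega>))\<^sup>2 / post_var (Y \<omega>) \<partial>M) / 2 + 1 - (\<integral>\<omega>. ratio (X \<omega>) (Y \<omega>) \<partial>M))"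
    unfolding gibbs_bound_def using ints by (simp add: prob_space)
  then show ?thesis
    using integral_ratio s W_square[THEN has_bochner_integral_integral_eq]
      normalized_residual_square[THEN has_bochner_integral_integral_eq]
    by simp
qed

section \<open>The entropy identity and the inequality\<close>

text \<open>From above \<open>ln t \<le> t - 1\<close> reduces to the integrable posterior variance;
  from below the Gibbs bound controls the logarithm.\<close>

lemma integrable_ln_post_var: "integrable M (\<lambda>\<omega>. ln (post_var (Y \<omega>) / s))"
proof (rule Bochner_Integration.integrable_bound)
  show "integrable M (\<lambda>\<omega>. \<bar>gibbs_bound \<omega>\<bar> + post_var (Y \<omega>) / s)"
    using integrable_gibbs_bound cond_var_X(2) by auto
  show "AE \<omega> in M. norm (ln (post_var (Y \<omega>) / s)) \<le> norm (\<bar>gibbs_bound \<omega>\<bar> + post_var (Y \<omega>) / s)"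
    using gibbs_bound_le
  proof eventually_elim
    case (elim \<omega>)
    have "0 < post_var (Y \<omega>) / s" using post_var_pos s by simp
    then show ?case
      using elim ln_le_minus_one[of "post_var (Y \<omega>) / s"] by auto
  qed
qed simp

text \<open>Along the posterior mean the transported density is
  \<open>mom 0 y / (post_var y / s)\<close>; its logarithm is a difference of two integrable terms,
  so the expectation may be split.\<close>

lemma entropy_post_mean:
  "has_finite_diff_entropy M (\<lambda>\<omega>. post_mean (Y \<omega>))"
  "diff_entropy M (\<lambda>\<omega>. post_mean (Y \<omega>)) = diff_entropy M Y + (\<integral>\<omega>. ln (post_var (Y \<omega>) / s) \<partial>M)"
proof -
  obtain r where r: "distributed M lborel (\<lambda>\<omega>. post_mean (Y \<omega>)) (\<lambda>x. ennreal (r x))"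
    "\<And>x. 0 \<le> r x" "\<And>y. r (post_mean y) = mom 0 y / (post_var y / s)"
  proof (rule distributed_increasing_image[OF Y_distributed _ _ post_mean_deriv])
    show "continuous_on UNIV (\<lambda>y. post_var y / s)"
      using continuous_post_var s by (intro continuous_intros) auto
  qed (use mom_0_pos post_var_pos s in \<open>auto simp: less_imp_le\<close>)
  have ln_r: "ln (r (post_mean y)) = ln (mom 0 y) - ln (post_var y / s)" for y
    unfolding r(3) using mom_0_pos[of y] post_var_pos[of y] s by (subst ln_div) auto
  have "integrable M (\<lambda>\<omega>. ln (r (post_mean (Y \<omega>))))"
    unfolding ln_r using integrable_ln_mom_0 integrable_ln_post_var by auto
  then show "has_finite_diff_entropy M (\<lambda>\<omega>. post_mean (Y \<omega>))"
    unfolding has_finite_diff_entropy_def using r integrable_ln_density_iff[OF r(1,2)] by auto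
  have "diff_entropy M (\<lambda>\<omega>. post_mean (Y \<omega>)) = - (\<integral>\<omega>. ln (mom 0 (Y \<omega>)) - ln (post_var (Y \<omega>) / s) \<partial>M)"
    unfolding diff_entropy_eq_expectation[OF r(1,2)] ln_r ..
  also have "\<dots> = - (\<integral>\<omega>. ln (mom 0 (Y \<omega>)) \<partial>M) + (\<integral>\<omega>. ln (post_var (Y \<omega>) / s) \<partial>M)"
    using integrable_ln_mom_0 integrable_ln_post_var by simp
  finally show "diff_entropy M (\<lambda>\<omega>. post_mean (Y \<omega>)) = diff_entropy M Y + (\<integral>\<omega>. ln (post_var (Y \<omega>) / s) \<partial>M)"
    using diff_entropy_eq_expectation[OF Y_distributed] mom_0_pos by (simp add: less_imp_le)
qed

lemma has_finite_diff_entropy_Y: "has_finite_diff_entropy M Y"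
  unfolding has_finite_diff_entropy_def
  using Y_distributed integrable_ln_mom_0 integrable_ln_density_iff[OF Y_distributed] mom_0_pos
  by (auto simp: less_imp_le intro!: exI[of _ "mom 0"])

lemma expected_ln_post_var_ge:
  "2 * diff_entropy M X - 2 * diff_entropy M Y \<le> (\<integral>\<omega>. ln (post_var (Y \<omega>) / s) \<partial>M)"
proof -
  have "(\<integral>\<omega>. gibbs_bound \<omega> \<partial>M) \<le> (\<integral>\<omega>. ln (post_var (Y \<omega>) / s) \<partial>M)"
    by (rule integral_mono_AE[OF integrable_gibbs_bound integrable_ln_post_var gibbs_bound_le])
  then show ?thesis
    using integral_gibbs_bound diff_entropy_eq_expectation[OF Y_distributed] diff_entropy_eq_expectation[OF p p_nn] mom_0_pos
    by (simp add: less_imp_le)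
qed

end

text \<open>The finiteness and integrability conjuncts ensure that the identity and the inequality
  concern genuine values, not the default 0 of a divergent Bochner integral.\<close>

theorem theorem1:
  fixes M :: "'a measure" and X W Y :: "'a \<Rightarrow> real" and \<sigma>W2 :: real
  assumes "prob_space M"
    and X_rv: "X \<in> borel_measurable M"
    and X_var: "integrable M (\<lambda>\<omega>. (X \<omega>)\<^sup>2)"
    and X_ent: "has_finite_diff_entropy M X"
    and pos: "\<sigma>W2 > 0"
    and W_gauss: "distributed M lborel W (\<lambda>x. ennreal (normal_density 0 (sqrt \<sigma>W2) x))"
    and indep: "prob_space.indep_var M borel X borel W"
    and Y_def: "Y = (\<lambda>\<omega>. X \<omega> + W \<omega>)"
  shows "has_finite_diff_entropy M (cond_exp_given M Y X)
       \<and> has_finite_diff_entropy M Y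
       \<and> integrable M (\<lambda>\<omega>. ln (cond_var_given M Y X \<omega> / \<sigma>W2))
       \<and> diff_entropy M (cond_exp_given M Y X)
           = diff_entropy M Y + (\<integral>\<omega>. ln (cond_var_given M Y X \<omega> / \<sigma>W2) \<partial>M)
       \<and> diff_entropy M (cond_exp_given M Y X) + diff_entropy M Y \<ge> 2 * diff_entropy M X"
proof -
  interpret prob_space M by fact
  obtain p where p: "distributed M lborel X (\<lambda>x. ennreal (p x))" "\<And>x. 0 \<le> p x"
    "integrable lborel (\<lambda>x. p x * ln (p x))"
    using X_ent unfolding has_finite_diff_entropy_def by blast
  interpret gaussian_channel_density M X W Y \<sigma>W2 p
    using assms p integrable_ln_density_iff[OF p(1,2)] by unfold_locales auto
  have [measurable]: "cond_var_given M Y X \<in> borel_measurable M"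
    unfolding cond_var_given_def by measurable
  have "has_finite_diff_entropy M (cond_exp_given M Y X)"
    using entropy_post_mean(1) has_finite_diff_entropy_cong_AE[OF cond_exp_X(1)] by simp
  moreover have "diff_entropy M (cond_exp_given M Y X) = diff_entropy M (\<lambda>\<omega>. post_mean (Y \<omega>))"
    by (rule diff_entropy_cong_AE[OF prob_space_axioms cond_exp_X(1)]) auto
  moreover have ae: "AE \<omega> in M. ln (cond_var_given M Y X \<omega> / \<sigma>W2) = ln (post_var (Y \<omega>) / \<sigma>W2)"
    using cond_var_X(1) by eventually_elim simp
  moreover have "integrable M (\<lambda>\<omega>. ln (cond_var_given M Y X \<omega> / \<sigma>W2))"
    using integrable_ln_post_var by (subst integrable_cong_AE[OF _ _ ae]) auto
  moreover have "(\<integral>\<omega>. ln (cond_var_given M Y X \<omega> / \<sigma>W2) \<partial>M) = (\<integral>\<omega>. ln (post_var (Y \<omega>) / \<sigma>W2) \<partial>M)"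
    using ae by (intro integral_cong_AE) auto
  \<comment> \<open>By the identity the sum of the two entropies is
    \<open>2 * diff_entropy M Y\<close> plus the mean logarithm, and
    \<open>expected_ln_post_var_ge\<close> bounds the latter below.\<close>
  ultimately show ?thesis
    using has_finite_diff_entropy_Y entropy_post_mean(2) expected_ln_post_var_ge by auto
qed

end
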